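(* For every integer $k \geq 42$ and every integer $n \geq k^2$, there exists a (nonempty) family of tournaments on $n$ vertices, each of which is $(2k+1)$-connected, has minimum out-degree at least $\frac{k^2+11k}{26}$, and is not $k$-linked.
   Context: All digraphs are finite and simple: no loops and no multiple (parallel) arcs; a pair of opposite arcs $xy$, $yx$ is allowed in a general digraph. A tournament is a digraph obtained by orienting each edge of a complete graph in exactly one direction. Paths are directed paths. For a digraph $D$, the minimum out-degree $\delta^+(D)$ is the minimum over all vertices $x$ of the number of vertices $y$ such that $xy$ is an arc. For a positive integer $m$, a digraph is $m$-connected if it has at least $m+1$ vertices and, after deleting any set $S$ of at most $m-1$ vertices, there exists a directed path from $x$ to $y$ for every ordered pair of distinct remaining vertices $x,y$. A digraph $D$ is $k$-linked if for every $2k$ distinct vertices $x_1,\ldots,x_k,y_1,\ldots,y_k$ in $D$, there exist $k$ pairwise vertex-disjoint directed paths $P_1,\ldots,P_k$ such that $P_i$ starts at $x_i$ and ends at $y_i$ for each $i\in\{1,\ldots,k\}$. *)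

theory Defs
  imports Complex_Main "HOL-Library.Disjoint_Sets" "Graph_Theory.Graph_Theory"
begin

text \<open>The locale \<^locale>\<open>digraph\<close> requires finiteness and excludes loops and parallel arcs.\<close>

locale tournament = digraph +
  assumes exactly_one_orientation:
    "\<lbrakk>u \<in> verts G; v \<in> verts G; u \<noteq> v\<rbrakk> \<Longrightarrow> (u \<rightarrow> v) \<noteq> (v \<rightarrow> u)"

definition vpath_between :: "('a,'b) pre_digraph \<Rightarrow> 'a \<Rightarrow> 'a vwalk \<Rightarrow> 'a \<Rightarrow> bool" where
  "vpath_between G x p y \<longleftrightarrow> vpath p G \<and> hd p = x \<and> last p = y"

text \<open>\<^const>\<open>out_degree\<close> counts arcs; in the absence of parallel arcs this is the number of
  out-neighbours. The minimum is meaningful for finite nonempty vertex sets only.\<close>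

definition min_out_degree :: "('a,'b) pre_digraph \<Rightarrow> nat" where
  "min_out_degree G = Min (out_degree G ` verts G)"

text \<open>For positive \<open>m\<close>, \<open>card S < m\<close> says that at most \<open>m - 1\<close> vertices are deleted.
  The cardinality bound forces \<open>verts G\<close>, hence every such \<open>S\<close>, to be finite.\<close>

definition m_connected :: "nat \<Rightarrow> ('a,'b) pre_digraph \<Rightarrow> bool" where
  "m_connected m G \<longleftrightarrow>
     card (verts G) \<ge> m + 1 \<and>
     (\<forall>S. S \<subseteq> verts G \<and> card S < m \<longrightarrow>
        (\<forall>x \<in> verts G - S. \<forall>y \<in> verts G - S. x \<noteq> y \<longrightarrow>
           (\<exists>p. vpath_between (G \<restriction> (verts G - S)) x p y)))"

definition k_linked :: "nat \<Rightarrow> ('a,'b) pre_digraph \<Rightarrow> bool" where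
  "k_linked k G \<longleftrightarrow>
     (\<forall>x y :: nat \<Rightarrow> 'a.
        x ` {1..k} \<subseteq> verts G \<and> y ` {1..k} \<subseteq> verts G \<and>
        inj_on x {1..k} \<and> inj_on y {1..k} \<and> x ` {1..k} \<inter> y ` {1..k} = {} \<longrightarrow>
        (\<exists>P. (\<forall>i \<in> {1..k}. vpath_between G (x i) (P i) (y i)) \<and>
             disjoint_family_on (\<lambda>i. set (P i)) {1..k}))"

end

theory Submission
  imports Defs
begin

text \<open>
  Write \<open>k = a + b\<close> and call the terminal pairs \<open>i \<le> a\<close> trapped and the pairs \<open>a < i\<close> crossing.
  Apart from the sources \<open>Src i\<close> and the targets \<open>Tgt i\<close>, the tournament consists of layers
  \<open>1, \<dots>, b\<close> and a large core. The core enters the layers only at layer 1, arcs between layers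
  go forward by at most one layer, and the crossing targets are seen only by layer \<open>b\<close> and by other
  terminals. A crossing source does not see the layers, so in a linkage its path meets every layer. The
  \<open>b\<close> crossing paths together thus leave at most \<open>width r - b\<close> vertices of each layer \<open>r\<close>. A
  trapped source sees nothing but layer vertices and foreign terminals, so each of the \<open>a\<close> trapped
  paths needs a layer vertex of its own. As only \<open>3 * b - 1 < a\<close> of them are left, there is no
  linkage (\<open>no_linkage\<close>).

  The widths are what connectivity asks for. With layers of width \<open>b\<close> the trapped paths would be
  blocked whatever the number of layers, but the first crossing target would have only \<open>2 * k - 1\<close>
  in-neighbours. Every further vertex of a layer may let one trapped path escape, which is harmless
  as long as the total excess stays below \<open>a\<close>; this limits the number of layers to the order
  of \<open>k\<close>, and the out-degree of a trapped source to the order of \<open>k\<^sup>2\<close>. Layer \<open>b - 1\<close> is wider because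
  the last layer has arcs to the crossing targets and therefore lacks them as in-neighbours.

  For the degree and most of the connectivity a single observation suffices: every vertex dominates a
  whole block, that is, the union of all layers or one of the three parts of the core
  (\<open>out_neighbourhood_contains_block\<close>). A block has at least \<open>N > 2 * k\<close> vertices, so it
  survives the deletion of \<open>2 * k\<close> vertices, and every survivor reaches the core, which remains
  strongly connected because its parts dominate one another cyclically. It remains to reach every
  survivor from the core (\<open>core_reaches\<close>); only the layers (\<open>reaches_layers\<close>) and the crossing
  targets (\<open>reaches_Tgt\<close>) need a count. Finally \<open>b = k div 4\<close> makes the union of the layers
  large enough, and a part of the core absorbs the remaining vertices.
\<close>

section \<open>The tournament\<close>

text \<open>
  \<open>Lay r j\<close> is the \<open>j\<close>-th vertex of layer \<open>r\<close>, and \<open>Core p t\<close> the \<open>t\<close>-th vertex of the core part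
  \<open>p < 3\<close>.
\<close>

datatype vertex = Src nat | Tgt nat | Lay nat nat | Core nat nat

text \<open>
  \<open>N\<close> is a lower bound for the sizes of all blocks, and hence for the out-degrees; \<open>m\<close> is the size of
  the core part that adjusts the number of vertices.
\<close>

locale trapped_pairs =
  fixes a b m N :: nat
  assumes b_ge: "2 \<le> b" and a_ge: "3 * b \<le> a"
    and N_gt: "2 * (a + b) < N"
    and N_layers: "N \<le> b * (b + 2) + (b - 1)"
    and N_core: "N \<le> m"
begin

text \<open>
  A last layer of width \<open>b + 2\<close> gives a crossing target \<open>2 * (a + b) + 1\<close> in-neighbours, together with
  the foreign sources and the trapped targets. The width \<open>2 * b + 1\<close> gives as many to the last
  layer, from the layer before it and the \<open>2 * a\<close> trapped terminals.
\<close>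

definition width :: "nat \<Rightarrow> nat" where
  "width r = (if Suc r = b then 2 * b + 1 else b + 2)"

definition layer :: "nat \<Rightarrow> vertex set" where
  "layer r = Lay r ` {..<width r}"

definition layers :: "vertex set" where
  "layers = (\<Union>r \<in> {1..b}. layer r)"

definition core_size :: "nat \<Rightarrow> nat" where
  "core_size p = (if p = 2 then m else N)"

definition core :: "nat \<Rightarrow> vertex set" where
  "core p = Core p ` {..<core_size p}"

definition blocks :: "vertex set set" where
  "blocks = insert layers (core ` {..<3})"

definition vertices :: "vertex set" where
  "vertices = Src ` {1..a + b} \<union> Tgt ` {1..a + b} \<union> layers \<union> (\<Union>p \<in> {..<3}. core p)"

text \<open>
  The entries that matter for the obstruction: no source sees its own target; trapped sources see the
  layers but not the core; crossing sources see core parts 1 and 2 but no layer; core part 0 enters layer 1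
  and nothing else enters a layer from the core; a vertex outside the terminals that sees a crossing
  target lies in the last layer. The arcs \<open>Src i \<rightarrow> Tgt j\<close> for \<open>i \<noteq> j\<close> and those from trapped to crossing
  targets are useless for a linkage, but they raise the connectivity. The remaining comparisons of
  indices only orient the arcs inside a class.
\<close>

fun beats :: "vertex \<Rightarrow> vertex \<Rightarrow> bool" where
  "beats (Src i) (Src j) \<longleftrightarrow> i < j"
| "beats (Src i) (Tgt j) \<longleftrightarrow> i \<noteq> j"
| "beats (Src i) (Lay r j) \<longleftrightarrow> i \<le> a"
| "beats (Src i) (Core p t) \<longleftrightarrow> a < i \<and> p \<noteq> 0"
| "beats (Tgt i) (Src j) \<longleftrightarrow> i = j"
| "beats (Tgt i) (Tgt j) \<longleftrightarrow> i < j"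
| "beats (Tgt i) (Lay r j) \<longleftrightarrow> i \<le> a \<or> r \<noteq> b"
| "beats (Tgt i) (Core p t) \<longleftrightarrow> a < i"
| "beats (Lay r j) (Src i) \<longleftrightarrow> a < i"
| "beats (Lay r j) (Tgt i) \<longleftrightarrow> a < i \<and> r = b"
| "beats (Lay r j) (Lay s l) \<longleftrightarrow> s = Suc r \<or> Suc s < r \<or> r = s \<and> j < l"
| "beats (Lay r j) (Core p t) \<longleftrightarrow> r \<noteq> 1 \<or> p \<noteq> 0"
| "beats (Core p t) (Src i) \<longleftrightarrow> i \<le> a \<or> p = 0"
| "beats (Core p t) (Tgt i) \<longleftrightarrow> i \<le> a"
| "beats (Core p t) (Lay r j) \<longleftrightarrow> r = 1 \<and> p = 0"
| "beats (Core p t) (Core q s) \<longleftrightarrow> q = Suc p mod 3 \<or> p = q \<and> t < s"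

lemma in_layer [simp]: "v \<in> layer r \<longleftrightarrow> (\<exists>j < width r. v = Lay r j)"
  by (auto simp: layer_def)

lemma in_core [simp]: "v \<in> core p \<longleftrightarrow> (\<exists>t < core_size p. v = Core p t)"
  by (auto simp: core_def)

lemma Lay_in_layers [simp]: "Lay r j \<in> layers \<longleftrightarrow> r \<in> {1..b} \<and> j < width r"
  by (auto simp: layers_def)

lemma layers_only_Lay [simp]: "Src i \<notin> layers" "Tgt i \<notin> layers" "Core p t \<notin> layers"
  by (auto simp: layers_def)

lemma in_vertices [simp]:
  "Src i \<in> vertices \<longleftrightarrow> i \<in> {1..a + b}"
  "Tgt i \<in> vertices \<longleftrightarrow> i \<in> {1..a + b}"
  "Lay r j \<in> vertices \<longleftrightarrow> r \<in> {1..b} \<and> j < width r"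
  "Core p t \<in> vertices \<longleftrightarrow> p < 3 \<and> t < core_size p"
  by (auto simp: vertices_def)

lemma finite_layer [simp]: "finite (layer r)" and card_layer [simp]: "card (layer r) = width r"
  by (auto simp: layer_def card_image inj_on_def)

lemma finite_layers [simp]: "finite layers"
  by (simp add: layers_def)

lemma finite_core [simp]: "finite (core p)"
  and card_core [simp]: "card (core p) = core_size p"
  by (auto simp: core_def card_image inj_on_def)

lemma finite_vertices [simp]: "finite vertices"
  by (simp add: vertices_def)

text \<open>The number of layer vertices that \<open>b\<close> paths meeting every layer can leave unused.\<close>

lemma sum_excess: "(\<Sum>r \<in> {1..b}. width r - b) = 3 * b - 1"
proof -
  have "(\<Sum>r \<in> {1..b}. width r - b) = (\<Sum>r \<in> {1..b}. 2 + (if r = b - 1 then b - 1 else 0))"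
    using b_ge by (intro sum.cong) (auto simp: width_def)
  also have "\<dots> = (\<Sum>r \<in> {1..b}. 2) + (\<Sum>r \<in> {1..b}. if r = b - 1 then b - 1 else 0)"
    by (rule sum.distrib)
  also have "\<dots> = 2 * b + (b - 1)"
    using b_ge by (subst sum.delta) auto
  finally show ?thesis using b_ge by simp
qed

lemma card_layers: "card layers = b * (b + 2) + (b - 1)"
proof -
  have "card layers = (\<Sum>r \<in> {1..b}. width r)"
    unfolding layers_def by (subst card_UN_disjoint) auto
  also have "\<dots> = (\<Sum>r \<in> {1..b}. (width r - b) + b)"
    by (intro sum.cong) (auto simp: width_def)
  also have "\<dots> = (3 * b - 1) + b * b"
    by (simp only: sum.distrib sum_excess) simp
  finally show ?thesis using b_ge by (simp add: algebra_simps)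
qed

lemma card_vertices: "card vertices = 2 * (a + b) + card layers + 2 * N + m"
proof -
  have "card (\<Union>p \<in> {..<3}. core p) = (\<Sum>p \<in> {..<3}. card (core p))"
    by (rule card_UN_disjoint) auto
  also have "\<dots> = 2 * N + m" by (simp add: core_size_def eval_nat_numeral)
  finally have "card (\<Union>p \<in> {..<3}. core p) = 2 * N + m" .
  moreover have "card (Src ` {1..a + b}) = a + b" "card (Tgt ` {1..a + b}) = a + b"
    by (auto simp: card_image inj_on_def)
  moreover have "card vertices = card (Src ` {1..a + b}) + card (Tgt ` {1..a + b})
      + card layers + card (\<Union>p \<in> {..<3}. core p)"
    unfolding vertices_def
    by (subst card_Un_disjoint; (auto simp: layers_def)?)+
  ultimately show ?thesis by simp
qed

lemma less_3_cases: "p < 3 \<Longrightarrow> p = 0 \<or> p = 1 \<or> p = 2" for p :: nat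
  by linarith

lemma beats_exactly_one:
  assumes "u \<in> vertices" "v \<in> vertices" "u \<noteq> v"
  shows "beats u v \<noteq> beats v u"
proof -
  have mod3: "(q = Suc p mod 3) \<noteq> (p = Suc q mod 3)" if "p < 3" "q < 3" "p \<noteq> q" for p q :: nat
    using less_3_cases[OF that(1)] less_3_cases[OF that(2)] that(3) by (elim disjE) simp_all
  have irrefl3: "p \<noteq> Suc p mod 3" if "p < 3" for p :: nat
    using less_3_cases[OF that] by (elim disjE) simp_all
  show ?thesis
  proof (cases u)
    case u: (Core p t)
    show ?thesis
    proof (cases v)
      case (Core q s)
      then show ?thesis
        using assms u mod3[of p q] irrefl3[of p] by (cases "p = q") (simp_all, linarith)
    qed (use assms u in auto)
  qed (use assms in \<open>cases v; auto\<close>)+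
qed

lemma not_beats_self:
  assumes "u \<in> vertices"
  shows "\<not> beats u u"
proof (cases u)
  case (Core p t)
  have "p \<noteq> Suc p mod 3" if "p < 3" using less_3_cases[OF that] by auto
  with Core assms show ?thesis by simp
qed auto

lemma core_is_block: "p < 3 \<Longrightarrow> core p \<in> blocks"
  by (simp add: blocks_def)

lemma out_neighbourhood_contains_block:
  assumes "u \<in> vertices"
  shows "\<exists>B \<in> blocks. \<forall>v \<in> B. beats u v"
proof -
  have "(\<forall>v \<in> layers. beats u v) \<or> (\<exists>p<3. \<forall>v \<in> core p. beats u v)"
  proof (cases u)
    case (Src i)
    have "(\<forall>v \<in> layers. beats u v) \<or> (\<forall>v \<in> core 1. beats u v)"
      using Src by (auto simp: layers_def)
    then show ?thesis by (meson one_less_numeral_iff semiring_norm(77))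
  next
    case (Tgt i)
    have "(\<forall>v \<in> layers. beats u v) \<or> (\<forall>v \<in> core 1. beats u v)"
      using Tgt by (auto simp: layers_def)
    then show ?thesis by (meson one_less_numeral_iff semiring_norm(77))
  next
    case (Lay r j)
    then have "\<forall>v \<in> core 1. beats u v" by auto
    then show ?thesis by (meson one_less_numeral_iff semiring_norm(77))
  next
    case (Core p t)
    then have "\<forall>v \<in> core (Suc p mod 3). beats u v" by auto
    moreover have "Suc p mod 3 < 3" by simp
    ultimately show ?thesis by blast
  qed
  then show ?thesis by (auto simp: blocks_def simp del: in_core)
qed

lemma block_large:
  assumes "B \<in> blocks"
  shows "N \<le> card B" "finite B" "B \<subseteq> vertices"
proof -
  show "N \<le> card B"
    using assms N_layers N_core b_ge by (auto simp: blocks_def card_layers core_size_def)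
  show "finite B" "B \<subseteq> vertices"
    using assms by (auto simp: blocks_def vertices_def simp del: in_core)
qed

lemma out_degree_ge:
  assumes "u \<in> vertices"
  shows "N \<le> card {v \<in> vertices. beats u v}"
proof -
  from out_neighbourhood_contains_block[OF assms] obtain B
    where B: "B \<in> blocks" "\<forall>v \<in> B. beats u v" by blast
  then have "B \<subseteq> {v \<in> vertices. beats u v}" using block_large(3)[OF B(1)] by blast
  then have "card B \<le> card {v \<in> vertices. beats u v}" by (intro card_mono) auto
  with block_large(1)[OF B(1)] show ?thesis by simp
qed

end

section \<open>The terminal pairs cannot be linked\<close>

text \<open>With \<open>f\<close> the layer of a vertex: a path that climbs by at most one layer per arc meets every layer.\<close>

lemma successively_intermediate_value:
  fixes f :: "'a \<Rightarrow> nat"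
  assumes "successively (\<lambda>u v. f v \<le> Suc (f u)) p" "p \<noteq> []" "f (hd p) \<le> r" "r \<le> f (last p)"
  shows "\<exists>v \<in> set p. f v = r"
  using assms
proof (induction p rule: induct_list012)
  case (3 u w p)
  show ?case
  proof (cases "f u = r")
    case False
    with 3 have "\<exists>v \<in> set (w # p). f v = r" by simp
    then show ?thesis by auto
  qed simp
qed auto

context trapped_pairs
begin

text \<open>
  The argument of the introduction: crossing paths use up the layers, and too few layer vertices
  remain for the trapped paths. Disjointness enters first by keeping every path away from the foreign
  terminals.
\<close>

lemma no_linkage:
  assumes path: "\<And>i. i \<in> {1..a + b} \<Longrightarrow> P i \<noteq> [] \<and> hd (P i) = Src i \<and> last (P i) = Tgt i \<and>
      successively beats (P i) \<and> set (P i) \<subseteq> vertices"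
    and disj: "disjoint_family_on (\<lambda>i. set (P i)) {1..a + b}"
  shows False
proof -
  have apart: "set (P i) \<inter> set (P j) = {}" if "i \<in> {1..a + b}" "j \<in> {1..a + b}" "i \<noteq> j" for i j
    using disj that by (auto simp: disjoint_family_on_def)
  have ends: "Src i \<in> set (P i)" "Tgt i \<in> set (P i)" if "i \<in> {1..a + b}" for i
    using path[OF that] hd_in_set last_in_set by metis+
  have own_Src: "j = i" if "i \<in> {1..a + b}" "Src j \<in> set (P i)" for i j
  proof -
    have "Src j \<in> vertices" using path[OF that(1)] that(2) by blast
    then have "j \<in> {1..a + b}" by simp
    with ends[of j] apart[OF that(1), of j] that(2) show ?thesis by blast
  qed
  have own_Tgt: "j = i" if "i \<in> {1..a + b}" "Tgt j \<in> set (P i)" for i j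
  proof -
    have "Tgt j \<in> vertices" using path[OF that(1)] that(2) by blast
    then have "j \<in> {1..a + b}" by simp
    with ends[of j] apart[OF that(1), of j] that(2) show ?thesis by blast
  qed

  have kinds: "u = Src i \<or> u = Tgt i \<or> (\<exists>r j. u = Lay r j \<and> u \<in> layers) \<or> (\<exists>p t. u = Core p t)"
    if i: "i \<in> {1..a + b}" and u: "u \<in> set (P i)" for i u
  proof -
    have "u \<in> vertices" using path[OF i] u by blast
    then show ?thesis
      by (cases u) (use u own_Src[OF i] own_Tgt[OF i] in auto)
  qed

  \<comment> \<open>The core and the sources lie below layer 1, the targets above layer \<open>b\<close>; on a crossing path the
    level rises by at most 1 per arc.\<close>
  define level where "level v = (case v of Lay r j \<Rightarrow> r | Tgt _ \<Rightarrow> Suc b | _ \<Rightarrow> 0)" for v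
  have crossing: "\<exists>v \<in> set (P i). v \<in> layer r" if i: "i \<in> {a<..a + b}" and r: "r \<in> {1..b}" for i r
  proof -
    have i': "i \<in> {1..a + b}" using i by auto
    note p = path[OF i']
    have "successively (\<lambda>u v. level v \<le> Suc (level u)) (P i)"
    proof (rule successively_mono)
      show "successively beats (P i)" using p by blast
    next
      fix u v assume uv: "u \<in> set (P i)" "v \<in> set (P i)" "beats u v"
      have "a < i" using i by simp
      with kinds[OF i' uv(1)] kinds[OF i' uv(2)] uv(3) show "level v \<le> Suc (level u)"
        by (elim disjE exE conjE) (auto simp: level_def)
    qed
    moreover have "level (hd (P i)) \<le> r" "r \<le> level (last (P i))"
      using p r by (auto simp: level_def)
    ultimately obtain v where v: "v \<in> set (P i)" "level v = r"
      using successively_intermediate_value[of level "P i" r] p by blast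
    with kinds[OF i' v(1)] r have "v \<in> layer r"
      by (auto simp: level_def)
    with v show ?thesis by blast
  qed

  define used where "used = (\<Union>i \<in> {a<..a + b}. set (P i))"
  have few_left: "card (layer r - used) \<le> width r - b" if r: "r \<in> {1..b}" for r
  proof -
    obtain g where g: "\<And>i. i \<in> {a<..a + b} \<Longrightarrow> g i \<in> set (P i) \<and> g i \<in> layer r"
      using crossing[OF _ r] by metis
    have "inj_on g {a<..a + b}"
    proof (rule inj_onI)
      fix i j assume ij: "i \<in> {a<..a + b}" "j \<in> {a<..a + b}" "g i = g j"
      then have "g i \<in> set (P i) \<inter> set (P j)" using g[of i] g[of j] by auto
      moreover have "i \<in> {1..a + b}" "j \<in> {1..a + b}" using ij by auto
      ultimately show "i = j" using apart[of i j] by blast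
    qed
    then have "card (g ` {a<..a + b}) = b" by (simp add: card_image)
    moreover have "g ` {a<..a + b} \<subseteq> layer r" using g by blast
    ultimately have "card (layer r - g ` {a<..a + b}) = width r - b"
      by (simp add: card_Diff_subset)
    moreover have "layer r - used \<subseteq> layer r - g ` {a<..a + b}"
      using g by (auto simp: used_def)
    ultimately show ?thesis by (metis card_mono finite_Diff finite_layer)
  qed
  have "layers - used = (\<Union>r \<in> {1..b}. layer r - used)"
    by (auto simp: layers_def)
  then have "card (layers - used) \<le> (\<Sum>r \<in> {1..b}. card (layer r - used))"
    using card_UN_le[of "{1..b}" "\<lambda>r. layer r - used"] by simp
  also have "\<dots> \<le> (\<Sum>r \<in> {1..b}. width r - b)"
    by (intro sum_mono few_left)
  also have "\<dots> < a" using sum_excess a_ge b_ge by linarith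
  finally have left: "card (layers - used) < a" .

  have trapped: "\<exists>v \<in> set (P i). v \<in> layers" if i: "i \<in> {1..a}" for i
  proof -
    have i': "i \<in> {1..a + b}" using i by auto
    note p = path[OF i']
    \<comment> \<open>The second vertex is neither \<open>Tgt i\<close> nor a foreign terminal, which leaves the layers.\<close>
    obtain v q where q: "P i = Src i # v # q"
      using p by (metis last.simps list.exhaust_sel vertex.distinct(1))
    with p have "beats (Src i) v" "v \<in> set (P i)" by auto
    with kinds[OF i' this(2)] i have "v \<in> layers" by auto
    with \<open>v \<in> set (P i)\<close> show ?thesis by blast
  qed
  then obtain f where f: "\<And>i. i \<in> {1..a} \<Longrightarrow> f i \<in> set (P i) \<and> f i \<in> layers" by metis
  have "inj_on f {1..a}"
  proof (rule inj_onI)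
    fix i j assume ij: "i \<in> {1..a}" "j \<in> {1..a}" "f i = f j"
    then have "f i \<in> set (P i) \<inter> set (P j)" using f[of i] f[of j] by auto
    moreover have "i \<in> {1..a + b}" "j \<in> {1..a + b}" using ij by auto
    ultimately show "i = j" using apart[of i j] by blast
  qed
  moreover have "f ` {1..a} \<subseteq> layers - used"
  proof clarify
    fix i assume i: "i \<in> {1..a}"
    have "f i \<notin> set (P j)" if "j \<in> {a<..a + b}" for j
    proof -
      have "i \<in> {1..a + b}" "j \<in> {1..a + b}" "i \<noteq> j" using i that by auto
      with apart[of i j] f[OF i] show ?thesis by blast
    qed
    with f[OF i] show "f i \<in> layers - used" by (auto simp: used_def)
  qed
  ultimately have "a \<le> card (layers - used)"
    using card_inj_on_le[of f "{1..a}" "layers - used"] by simp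
  with left show False by simp
qed

section \<open>Connectivity\<close>

definition reaches :: "vertex set \<Rightarrow> vertex \<Rightarrow> vertex \<Rightarrow> bool" where
  "reaches S = (\<lambda>u v. u \<in> vertices - S \<and> v \<in> vertices - S \<and> beats u v)\<^sup>*\<^sup>*"

context
  fixes S assumes S_sub: "S \<subseteq> vertices" and S_small: "card S \<le> 2 * (a + b)"
begin

lemma finite_S: "finite S"
  using finite_subset[OF S_sub finite_vertices] .

lemma survivor:
  assumes "finite B" "card S < card B"
  obtains v where "v \<in> B" "v \<notin> S"
  using assms finite_S by (meson card_mono leD subsetI)

lemma reaches_trans: "reaches S u v \<Longrightarrow> reaches S v w \<Longrightarrow> reaches S u w"
  unfolding reaches_def by (rule rtranclp_trans)

lemma reaches_step: "beats u v \<Longrightarrow> u \<in> vertices - S \<Longrightarrow> v \<in> vertices - S \<Longrightarrow> reaches S u v"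
  unfolding reaches_def by (rule r_into_rtranclp) blast

lemma block_survivor:
  assumes "B \<in> blocks"
  obtains v where "v \<in> B" "v \<in> vertices - S"
proof -
  have "card S < card B" using block_large(1)[OF assms] S_small N_gt by linarith
  with survivor[of B] block_large[OF assms] that show ?thesis by blast
qed

lemma core_step:
  assumes "x \<in> core p" "x \<in> vertices - S" "y \<in> core (Suc p mod 3)" "y \<in> vertices - S"
  shows "reaches S x y"
  using assms by (intro reaches_step) auto

text \<open>One, two or three steps around the cyclic order of the parts lead to any part.\<close>

lemma core_reaches_core:
  assumes u: "u \<in> core p" "u \<in> vertices - S" and v: "v \<in> core q" "v \<in> vertices - S"
    and "p < 3" "q < 3"
  shows "reaches S u v"
proof -
  define p' where "p' = Suc p mod 3"
  define p'' where "p'' = Suc p' mod 3"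
  obtain w where w: "w \<in> core p'" "w \<in> vertices - S"
    using block_survivor core_is_block[of p'] by (auto simp: p'_def simp del: in_core)
  obtain w' where w': "w' \<in> core p''" "w' \<in> vertices - S"
    using block_survivor core_is_block[of p''] by (auto simp: p''_def simp del: in_core)
  have uw: "reaches S u w" and ww': "reaches S w w'"
    using core_step u w w' unfolding p'_def p''_def by blast+
  have "q = p' \<or> q = p'' \<or> q = Suc p'' mod 3"
    using less_3_cases[OF \<open>p < 3\<close>] less_3_cases[OF \<open>q < 3\<close>] by (auto simp: p''_def p'_def)
  then consider "q = p'" | "q = p''" | "q = Suc p'' mod 3" by blast
  then show ?thesis
  proof cases
    case 1
    then show ?thesis using core_step u v unfolding p'_def by blast
  next
    case 2
    then have "reaches S w v" using core_step w v unfolding p''_def by blast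
    with uw show ?thesis by (rule reaches_trans)
  next
    case 3
    then have "reaches S w' v" using core_step w' v by blast
    with uw ww' show ?thesis by (blast intro: reaches_trans)
  qed
qed

text \<open>Every vertex dominates a block, some vertex of the block survives, and layers dominate core part 1.\<close>

lemma reaches_core:
  assumes u: "u \<in> vertices - S" and c: "c \<in> core 0" "c \<in> vertices - S"
  shows "reaches S u c"
proof -
  have lay: "reaches S v c" if v: "v \<in> layers" "v \<in> vertices - S" for v
  proof -
    obtain w where w: "w \<in> core 1" "w \<in> vertices - S"
      using block_survivor[OF core_is_block, of 1] by auto
    have "beats v w" using v w by (cases v) auto
    with v w have "reaches S v w" by (intro reaches_step)
    moreover have "reaches S w c" by (rule core_reaches_core[OF w c]) auto
    ultimately show ?thesis by (rule reaches_trans)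
  qed
  from out_neighbourhood_contains_block[of u] u obtain B
    where B: "B \<in> blocks" "\<forall>v \<in> B. beats u v" by blast
  obtain v where v: "v \<in> B" "v \<in> vertices - S" using block_survivor[OF B(1)] .
  have "reaches S u v" using B v u by (intro reaches_step) auto
  moreover have "reaches S v c"
  proof (cases "B = layers")
    case True
    with lay v show ?thesis by blast
  next
    case False
    with B(1) obtain p where p: "p < 3" "B = core p" by (auto simp: blocks_def)
    show ?thesis by (rule core_reaches_core[OF _ v(2) c]) (use p v in auto)
  qed
  ultimately show ?thesis by (rule reaches_trans)
qed

context
  fixes c assumes c: "c \<in> core 0" "c \<in> vertices - S"
begin

lemma from_step: "reaches S c u \<Longrightarrow> u \<in> vertices - S \<Longrightarrow> beats u v \<Longrightarrow> v \<in> vertices - S \<Longrightarrow> reaches S c v"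
  by (meson reaches_step reaches_trans)

lemma reaches_Src:
  assumes "Src i \<in> vertices - S" shows "reaches S c (Src i)"
  using assms c by (intro reaches_step) auto

lemma reaches_trapped_Tgt:
  assumes "Tgt i \<in> vertices - S" "i \<le> a" shows "reaches S c (Tgt i)"
  using assms c by (intro reaches_step) auto

lemma reaches_first_layer:
  assumes "Lay 1 j \<in> vertices - S" shows "reaches S c (Lay 1 j)"
  using assms c by (intro reaches_step) auto

lemma reaches_next_layer:
  assumes "u \<in> layer r" "u \<notin> S" "reaches S c u" "r \<in> {1..b}"
    and "Lay (Suc r) j \<in> vertices - S"
  shows "reaches S c (Lay (Suc r) j)"
  using from_step[OF assms(3)] assms by auto

text \<open>
  A surviving trapped terminal dominates all layers. Otherwise the \<open>2 * a\<close> trapped terminals are deleted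
  and at most \<open>2 * b\<close> further deletions remain. If no layer is deleted completely, one
  can climb from layer to layer. If some layer is, at most \<open>b - 2\<close> deletions are left for the
  crossing terminals, and a surviving arc \<open>Src x \<rightarrow> Tgt y\<close> with \<open>x \<noteq> y\<close> bypasses that layer, as
  \<open>Tgt y\<close> dominates all layers except the last; the last layer is entered from layer \<open>b - 1\<close>, which is
  too wide to be deleted.
\<close>

lemma reaches_layers:
  assumes "Lay r j \<in> vertices - S"
  shows "reaches S c (Lay r j)"
proof (cases "Src ` {1..a} \<union> Tgt ` {1..a} \<subseteq> S")
  case False
  then obtain u i where i: "i \<in> {1..a}" and "u = Src i \<or> u = Tgt i" "u \<notin> S" by blast
  then have "reaches S c u" "u \<in> vertices - S" "beats u (Lay r j)"
    using reaches_Src reaches_trapped_Tgt by auto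
  with from_step assms show ?thesis by blast
next
  case True
  let ?T = "Src ` {1..a} \<union> Tgt ` {1..a}"
  have cardT: "card ?T = 2 * a"
    by (subst card_Un_disjoint) (auto simp: card_image inj_on_def)
  have rest: "card (S - ?T) \<le> 2 * b"
    using S_small True cardT by (simp add: card_Diff_subset)
  have fin: "finite (S - ?T)" using finite_S by simp
  have fat: "\<exists>u \<in> layer (b - 1). u \<notin> S"
  proof (rule ccontr)
    assume "\<not> ?thesis"
    then have "layer (b - 1) \<subseteq> S - ?T" by auto
    from card_mono[OF fin this] rest b_ge show False by (simp add: width_def)
  qed
  show ?thesis
  proof (cases "\<exists>s \<in> {1..b}. layer s \<subseteq> S")
    case False
    have "Lay r j \<in> vertices - S \<Longrightarrow> reaches S c (Lay r j)" for r j
    proof (induction r arbitrary: j)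
      case (Suc r)
      show ?case
      proof (cases "r = 0")
        case True
        with reaches_first_layer Suc.prems show ?thesis by simp
      next
        case r: False
        with Suc.prems have rb: "r \<in> {1..b}" by auto
        with False obtain u where u: "u \<in> layer r" "u \<notin> S" by blast
        then obtain l where "u = Lay r l" by auto
        with u rb Suc.IH[of l] have "reaches S c u" by auto
        with reaches_next_layer u rb Suc.prems show ?thesis by blast
      qed
    qed auto
    with assms show ?thesis by blast
  next
    case True
    then obtain s where s: "s \<in> {1..b}" "layer s \<subseteq> S" by blast
    define R where "R = S - ?T - layer s"
    have "layer s \<subseteq> S - ?T" using s by auto
    then have "card R = card (S - ?T) - width s"
      by (simp add: R_def card_Diff_subset)
    moreover have "Suc s \<noteq> b" using s fat by fastforce
    ultimately have R: "card R + 2 \<le> b"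
      using rest card_mono[OF fin \<open>layer s \<subseteq> S - ?T\<close>] by (simp add: width_def)
    have finR: "finite R" using finite_S by (simp add: R_def)
    have "\<exists>y \<in> {a<..a + b}. Tgt y \<notin> S"
    proof (rule ccontr)
      assume "\<not> ?thesis"
      then have "Tgt ` {a<..a + b} \<subseteq> R" by (auto simp: R_def)
      from card_mono[OF finR this] R show False by (simp add: card_image inj_on_def)
    qed
    then obtain y where y: "y \<in> {a<..a + b}" "Tgt y \<notin> S" ..
    have "\<exists>x \<in> {a<..a + b} - {y}. Src x \<notin> S"
    proof (rule ccontr)
      assume "\<not> ?thesis"
      then have "Src ` ({a<..a + b} - {y}) \<subseteq> R" by (auto simp: R_def)
      from card_mono[OF finR this] R y show False by (simp add: card_image inj_on_def)
    qed
    then obtain x where x: "x \<in> {a<..a + b}" "x \<noteq> y" "Src x \<notin> S" by blast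
    have "reaches S c (Tgt y)"
      using from_step[of "Src x" "Tgt y"] reaches_Src[of x] x y by auto
    then have early: "reaches S c (Lay r j)" if "r \<noteq> b" "Lay r j \<in> vertices - S" for r j
      using from_step[of "Tgt y" "Lay r j"] y that by auto
    show ?thesis
    proof (cases "r = b")
      case True
      from fat obtain u where u: "u \<in> layer (b - 1)" "u \<notin> S" by blast
      then have "reaches S c u" using early b_ge by auto
      with reaches_next_layer[of u "b - 1" j] u b_ge assms True show ?thesis by auto
    qed (use early assms in blast)
  qed
qed

text \<open>
  A crossing target has \<open>2 * (a + b) + 1\<close> in-neighbours among the foreign sources, the trapped targets
  and the last layer, so one of them survives; all of these are known to be reached.
\<close>

lemma reaches_Tgt:
  assumes "Tgt i \<in> vertices - S"
  shows "reaches S c (Tgt i)"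
proof (cases "i \<le> a")
  case True
  with assms reaches_trapped_Tgt show ?thesis by blast
next
  case False
  let ?X = "Src ` ({1..a + b} - {i})" and ?Y = "Tgt ` {1..a}"
  have i: "i \<in> {1..a + b}" using assms by simp
  have "card (?X \<union> ?Y \<union> layer b) = card ?X + card ?Y + card (layer b)"
    by (subst card_Un_disjoint; (auto)?)+
  also have "\<dots> = (a + b - 1) + a + (b + 2)"
    using i by (simp add: card_image inj_on_def width_def)
  finally have "card S < card (?X \<union> ?Y \<union> layer b)"
    using S_small b_ge by simp
  moreover have "finite (?X \<union> ?Y \<union> layer b)" by simp
  ultimately obtain u where u: "u \<in> ?X \<union> ?Y \<union> layer b" "u \<notin> S"
    by (meson survivor)
  then have "u \<in> vertices - S" "beats u (Tgt i)" "reaches S c u"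
    using False b_ge reaches_Src reaches_trapped_Tgt reaches_layers by auto
  with from_step assms show ?thesis by blast
qed

lemma core_reaches:
  assumes "v \<in> vertices - S"
  shows "reaches S c v"
proof (cases v)
  case (Core p t)
  with assms c core_reaches_core[of c 0 v p] show ?thesis by auto
qed (use assms reaches_Src reaches_Tgt reaches_layers in auto)

end

lemma survivors_strongly_connected:
  assumes "u \<in> vertices - S" "v \<in> vertices - S"
  shows "reaches S u v"
proof -
  obtain c where "c \<in> core 0" "c \<in> vertices - S"
    using block_survivor[OF core_is_block, of 0] by auto
  with assms reaches_core core_reaches reaches_trans show ?thesis by blast
qed

end

section \<open>Realisation on an initial segment of the natural numbers\<close>

context
  fixes dec :: "nat \<Rightarrow> vertex" and n :: nat
  assumes bij: "bij_betw dec {..<n} vertices"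
begin

definition T :: "(nat, nat \<times> nat) pre_digraph" where
  "T = \<lparr>verts = {..<n}, arcs = {(u, v). u < n \<and> v < n \<and> beats (dec u) (dec v)},
        tail = fst, head = snd\<rparr>"

lemma verts_T [simp]: "verts T = {..<n}"
  by (simp add: T_def)

lemma arcs_ends_T: "arcs_ends T = {(u, v). u < n \<and> v < n \<and> beats (dec u) (dec v)}"
  by (auto simp: T_def arcs_ends_conv)

lemma dec_in: "u < n \<Longrightarrow> dec u \<in> vertices"
  using bij by (auto simp: bij_betw_def)

lemma dec_inj: "u < n \<Longrightarrow> v < n \<Longrightarrow> dec u = dec v \<longleftrightarrow> u = v"
  using bij by (auto simp: bij_betw_def inj_on_def)

lemma dec_surj:
  assumes "w \<in> vertices"
  obtains u where "u < n" "dec u = w"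
proof -
  have "w \<in> dec ` {..<n}" using assms bij by (simp add: bij_betw_def)
  with that show ?thesis by auto
qed

lemma card_verts_T: "card vertices = n"
  using bij_betw_same_card[OF bij] by simp

lemma tournament_T: "tournament T"
proof
  show "finite (arcs T)"
    by (rule finite_subset[of _ "{..<n} \<times> {..<n}"]) (auto simp: T_def)
  show "(u \<rightarrow>\<^bsub>T\<^esub> v) \<noteq> (v \<rightarrow>\<^bsub>T\<^esub> u)" if "u \<in> verts T" "v \<in> verts T" "u \<noteq> v" for u v
    using that beats_exactly_one[of "dec u" "dec v"] dec_in dec_inj by (auto simp: arcs_ends_T)
qed (auto simp: T_def arc_to_ends_def not_beats_self dec_in)

lemma min_out_degree_T: "N \<le> min_out_degree T"
proof -
  have "N \<le> out_degree T u" if u: "u < n" for u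
  proof -
    have "out_arcs T u = Pair u ` {v \<in> {..<n}. beats (dec u) (dec v)}"
      using u by (auto simp: out_arcs_def T_def)
    then have "out_degree T u = card {v \<in> {..<n}. beats (dec u) (dec v)}"
      by (simp add: out_degree_def card_image inj_on_def)
    also have "\<dots> = card (dec ` {v \<in> {..<n}. beats (dec u) (dec v)})"
      by (intro card_image[symmetric] inj_on_subset[OF bij_betw_imp_inj_on[OF bij]]) auto
    also have "dec ` {v \<in> {..<n}. beats (dec u) (dec v)} = {w \<in> vertices. beats (dec u) w}"
      by (auto simp: dec_in elim: dec_surj)
    finally show ?thesis using out_degree_ge[OF dec_in[OF u]] by simp
  qed
  moreover have "0 < n" using card_verts_T card_vertices N_gt by simp
  ultimately show ?thesis unfolding min_out_degree_def by (subst Min_ge_iff) auto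
qed

lemma wf_induced_T: "wf_digraph (T \<restriction> U)"
proof -
  interpret tournament T by (rule tournament_T)
  show ?thesis by (rule wellformed_induce_subgraph)
qed

lemma reaches_imp_reachable:
  assumes "reaches (dec ` S) (dec x) w" and S: "S \<subseteq> {..<n}" and x: "x \<in> {..<n} - S"
  shows "\<exists>y \<in> {..<n} - S. dec y = w \<and> x \<rightarrow>\<^sup>*\<^bsub>T \<restriction> ({..<n} - S)\<^esub> y"
  using assms(1) unfolding reaches_def
proof (induction rule: rtranclp_induct)
  case base
  from x have "x \<rightarrow>\<^sup>*\<^bsub>T \<restriction> ({..<n} - S)\<^esub> x"
    by (intro wf_digraph.reachable_refl[OF wf_induced_T]) simp
  with x show ?case by blast
next
  case (step v w)
  then obtain y where y: "y \<in> {..<n} - S" "dec y = v" "x \<rightarrow>\<^sup>*\<^bsub>T \<restriction> ({..<n} - S)\<^esub> y" by blast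
  from step obtain z where z: "z < n" "dec z = w" by (auto elim: dec_surj)
  with step have "z \<in> {..<n} - S" by auto
  moreover have "(y, z) \<in> arcs_ends (T \<restriction> ({..<n} - S))"
    using y z step \<open>z \<in> _\<close> by (auto simp: arcs_ends_conv T_def)
  moreover from this have "x \<rightarrow>\<^sup>*\<^bsub>T \<restriction> ({..<n} - S)\<^esub> z"
    by (rule wf_digraph.reachable_adj_trans[OF wf_induced_T y(3)])
  ultimately show ?case using z by blast
qed

lemma m_connected_T: "m_connected (2 * (a + b) + 1) T"
  unfolding m_connected_def
proof (intro conjI allI impI ballI)
  show "2 * (a + b) + 1 + 1 \<le> card (verts T)"
    using card_verts_T card_vertices N_gt by simp
next
  fix S x y
  assume S: "S \<subseteq> verts T \<and> card S < 2 * (a + b) + 1"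
    and x: "x \<in> verts T - S" and y: "y \<in> verts T - S"
  have "finite S" using S finite_subset by auto
  then have "card (dec ` S) \<le> 2 * (a + b)" using S card_image_le[of S dec] by linarith
  moreover have "dec ` S \<subseteq> vertices" using S dec_in by auto
  moreover have survive: "dec u \<in> vertices - dec ` S" if "u \<in> verts T - S" for u
    using that S dec_in dec_inj by (auto simp: subset_iff)
  ultimately have "reaches (dec ` S) (dec x) (dec y)"
    using survivors_strongly_connected survive[OF x] survive[OF y] by blast
  with reaches_imp_reachable[of S x "dec y"] S x obtain z
    where "z \<in> {..<n} - S" "dec z = dec y" "x \<rightarrow>\<^sup>*\<^bsub>T \<restriction> ({..<n} - S)\<^esub> z" by auto
  then have "x \<rightarrow>\<^sup>*\<^bsub>T \<restriction> (verts T - S)\<^esub> y" using y dec_inj by auto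
  then show "\<exists>p. vpath_between (T \<restriction> (verts T - S)) x p y"
    using wf_digraph.reachable_vpath_conv[OF wf_induced_T] by (simp add: vpath_between_def)
qed

lemma vwalk_successively_beats:
  "set (vwalk_arcs p) \<subseteq> arcs_ends T \<Longrightarrow> successively beats (map dec p)"
  by (induction p rule: vwalk_arcs.induct) (auto simp: arcs_ends_T)

lemma not_k_linked_T: "\<not> k_linked (a + b) T"
proof
  assume linked: "k_linked (a + b) T"
  define enc where "enc = inv_into {..<n} dec"
  have enc: "enc w < n" "dec (enc w) = w" if "w \<in> vertices" for w
    using that bij bij_betw_inv_into_right[OF bij] inv_into_into[of w dec "{..<n}"]
    by (auto simp: enc_def bij_betw_def)
  have S: "Src i \<in> vertices" "Tgt i \<in> vertices" if "i \<in> {1..a + b}" for i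
    using that by auto
  let ?x = "\<lambda>i. enc (Src i)" and ?y = "\<lambda>i. enc (Tgt i)"
  have "?x ` {1..a + b} \<subseteq> verts T" "?y ` {1..a + b} \<subseteq> verts T"
    using enc(1)[OF S(1)] enc(1)[OF S(2)] by auto
  moreover have "inj_on ?x {1..a + b}"
    by (rule inj_onI) (metis enc(2) S(1) vertex.inject(1))
  moreover have "inj_on ?y {1..a + b}"
    by (rule inj_onI) (metis enc(2) S(2) vertex.inject(2))
  moreover have "?x i \<noteq> ?y j" if "i \<in> {1..a + b}" "j \<in> {1..a + b}" for i j
    using enc(2)[OF S(1)[OF that(1)]] enc(2)[OF S(2)[OF that(2)]] by auto
  then have "?x ` {1..a + b} \<inter> ?y ` {1..a + b} = {}"
    by blast
  ultimately have "\<exists>P. (\<forall>i \<in> {1..a + b}. vpath_between T (?x i) (P i) (?y i)) \<and>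
      disjoint_family_on (\<lambda>i. set (P i)) {1..a + b}"
    by (intro linked[unfolded k_linked_def, rule_format] conjI)
  then obtain P
    where P: "\<And>i. i \<in> {1..a + b} \<Longrightarrow> vpath_between T (?x i) (P i) (?y i)"
      and disj: "disjoint_family_on (\<lambda>i. set (P i)) {1..a + b}"
    by blast
  have sub: "set (P i) \<subseteq> {..<n}" if "i \<in> {1..a + b}" for i
    using P[OF that] by (simp add: vpath_between_def vpath_def vwalk_def)
  show False
  proof (rule no_linkage)
    fix i assume i: "i \<in> {1..a + b}"
    from P[OF i] have p: "P i \<noteq> []" "set (vwalk_arcs (P i)) \<subseteq> arcs_ends T"
        "hd (P i) = ?x i" "last (P i) = ?y i"
      by (auto simp: vpath_between_def vpath_def vwalk_def)
    then show "map dec (P i) \<noteq> [] \<and> hd (map dec (P i)) = Src i \<and> last (map dec (P i)) = Tgt i \<and>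
        successively beats (map dec (P i)) \<and> set (map dec (P i)) \<subseteq> vertices"
      using vwalk_successively_beats[OF p(2)] sub[OF i] enc(2)[OF S(1)[OF i]] enc(2)[OF S(2)[OF i]] dec_in
      by (auto simp: hd_map last_map)
  next
    show "disjoint_family_on (\<lambda>i. set (map dec (P i))) {1..a + b}"
    proof (unfold disjoint_family_on_def, intro ballI impI)
      fix i j assume ij: "i \<in> {1..a + b}" "j \<in> {1..a + b}" "i \<noteq> j"
      then have "set (P i) \<inter> set (P j) = {}" using disj by (auto simp: disjoint_family_on_def)
      then show "set (map dec (P i)) \<inter> set (map dec (P j)) = {}"
        using inj_on_image_Int[OF bij_betw_imp_inj_on[OF bij] sub[OF ij(1)] sub[OF ij(2)]] by simp
    qed
  qed
qed

end

lemma tournament_exists: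
  "\<exists>T :: (nat, nat \<times> nat) pre_digraph. tournament T \<and> card (verts T) = card vertices \<and>
     m_connected (2 * (a + b) + 1) T \<and> N \<le> min_out_degree T \<and> \<not> k_linked (a + b) T"
proof -
  obtain dec where dec: "bij_betw dec {..<card vertices} vertices"
    using ex_bij_betw_nat_finite[OF finite_vertices] by (auto simp: atLeast0LessThan)
  show ?thesis
    using tournament_T[OF dec] m_connected_T[OF dec] min_out_degree_T[OF dec] not_k_linked_T[OF dec]
      verts_T[OF dec] by (metis card_lessThan)
qed

end

theorem theorem4:
  fixes k n :: nat
  assumes "k \<ge> 42" and "n \<ge> k\<^sup>2"
  shows "\<exists>F :: (nat, nat \<times> nat) pre_digraph set.
    F \<noteq> {} \<and>
    (\<forall>T \<in> F. tournament T \<and> card (verts T) = n \<and>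
       m_connected (2 * k + 1) T \<and>
       real (min_out_degree T) \<ge> ((real k)\<^sup>2 + 11 * real k) / 26 \<and>
       \<not> k_linked k T)"
proof -
  \<comment> \<open>The total excess \<open>3 * b - 1\<close> has to stay below \<open>a = k - b\<close>, and \<open>k div 4\<close> is the largest \<open>b\<close>
    with this property. The value of \<open>N\<close> is the number of layer vertices.\<close>
  define b where "b = k div 4"
  define a where "a = k - b"
  define N where "N = b * (b + 2) + (b - 1)"
  define m where "m = n - (2 * k + N + 2 * N)"
  have b: "10 \<le> b" "4 * b \<le> k" "k \<le> 4 * b + 3" using assms by (auto simp: b_def)
  have bb: "10 * b \<le> b * b" using b by simp
  have k: "a + b = k" using b by (simp add: a_def)
  have N: "N + 1 = b * b + 3 * b" using b by (simp add: N_def algebra_simps)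
  have "(4 * b) * (4 * b) \<le> k * k" using b by (intro mult_mono) auto
  then have kk: "16 * (b * b) \<le> k\<^sup>2" by (simp add: power2_eq_square)
  have "4 * N + 2 * k \<le> n" using kk assms(2) b bb N by linarith
  then have m: "2 * k + N + 2 * N + m = n" "N \<le> m"
    by (auto simp: m_def)
  have "13 * b \<le> N + 1" using bb N by linarith
  then have large: "2 * (a + b) < N" using b unfolding k by linarith
  interpret trapped_pairs a b m N
  proof
    show "3 * b \<le> a" using k b by linarith
  qed (use b m large in \<open>auto simp: N_def\<close>)
  have "card vertices = n"
    using card_vertices card_layers m k by (simp add: N_def)
  with tournament_exists k obtain T :: "(nat, nat \<times> nat) pre_digraph" where
    T: "tournament T" "card (verts T) = n" "m_connected (2 * k + 1) T"
       "N \<le> min_out_degree T" "\<not> k_linked k T" by metis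
  have "k * k \<le> (4 * b + 3) * (4 * b + 3)" using b by (intro mult_mono) auto
  also have "\<dots> = 16 * (b * b) + 24 * b + 9" by (simp add: algebra_simps)
  finally have "k\<^sup>2 + 11 * k \<le> 26 * N"
    using b bb N by (simp add: power2_eq_square)
  also have "\<dots> \<le> 26 * min_out_degree T" using T by simp
  finally have "real (k\<^sup>2 + 11 * k) \<le> real (26 * min_out_degree T)" by (rule of_nat_mono)
  then have "((real k)\<^sup>2 + 11 * real k) / 26 \<le> real (min_out_degree T)" by simp
  with T show ?thesis by (intro exI[of _ "{T}"]) auto
qed

end
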